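(* (1) Let $\underline{D}=(D;\sqcap,\sqcup,\neg,\lrcorner,\bot,\top)$ be a pure and trivial double Boolean algebra. Then the ordered set $(D;\sqsubseteq)$ is the glued sum $(D_{\sqcap};\sqsubseteq)\overset{\bullet}{+}(D_{\sqcup};\sqsubseteq)$; in particular the greatest element of $D_\sqcap$ is identified with the least element of $D_\sqcup$. (2) Conversely, let $\underline{P}=(P;\wedge_P,\vee_P,{}^{\prime_P},0_P,1_P)$ and $\underline{Q}=(Q;\wedge_Q,\vee_Q,{}^{\prime_Q},0_Q,1_Q)$ be Boolean algebras and let $D=P\overset{\bullet}{+}Q$ (so $D=P\cup Q$ with $P\cap Q=\{1_P\}=\{0_Q\}$). Put $\bot=0_P$, $\top=1_Q$ and for $x,y\in D$ define $x\sqcap y=x\wedge_P y$ if $x,y\in P$; $x\sqcap y=1_P$ if $x,y\in Q$; $x\sqcap y=x$ if $x\in P,y\in Q$; $x\sqcap y=y$ if $x\in Q,y\in P$; $x\sqcup y=x\vee_Q y$ if $x,y\in Q$; $x\sqcup y=0_Q$ if $x,y\in P$; $x\sqcup y=y$ if $x\in P,y\in Q$; $x\sqcup y=x$ if $x\in Q,y\in P$; $\neg x=x^{\prime_P}$ if $x\in P$ and $\neg x=0_P$ otherwise; $\lrcorner x=x^{\prime_Q}$ if $x\in Q$ and $\lrcorner x=1_Q$ otherwise. Then $(D;\sqcap,\sqcup,\neg,\lrcorner,\bot,\top)$ is a pure and trivial double Boolean algebra.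
   Context: A double Boolean algebra (dBa) is an algebra $\underline{D}=(D;\sqcap,\sqcup,\neg,\lrcorner,\bot,\top)$ of type $(2,2,1,1,0,0)$ satisfying, for all $x,y,z$, where $x\vee y:=\neg(\neg x\sqcap\neg y)$ and $x\wedge y:=\lrcorner(\lrcorner x\sqcup\lrcorner y)$: $(x\sqcap x)\sqcap y=x\sqcap y$; $(x\sqcup x)\sqcup y=x\sqcup y$; $\sqcap$ and $\sqcup$ are commutative and associative; $x\sqcap(x\sqcup y)=x\sqcap x$; $x\sqcup(x\sqcap y)=x\sqcup x$; $x\sqcap(x\vee y)=x\sqcap x$; $x\sqcup(x\wedge y)=x\sqcup x$; $x\sqcap(y\vee z)=(x\sqcap y)\vee(x\sqcap z)$; $x\sqcup(y\wedge z)=(x\sqcup y)\wedge(x\sqcup z)$; $\neg\neg(x\sqcap y)=x\sqcap y$; $\lrcorner\lrcorner(x\sqcup y)=x\sqcup y$; $\neg(x\sqcap x)=\neg x$; $\lrcorner(x\sqcup x)=\lrcorner x$; $x\sqcap\neg x=\bot$; $x\sqcup\lrcorner x=\top$; $\neg\bot=\top\sqcap\top$; $\lrcorner\top=\bot\sqcup\bot$; $\neg\top=\bot$; $\lrcorner\bot=\top$; $(x\sqcap x)\sqcup(x\sqcap x)=(x\sqcup x)\sqcap(x\sqcup x)$. Let $D_\sqcap=\{x\in D: x\sqcap x=x\}$, $D_\sqcup=\{x\in D: x\sqcup x=x\}$. $\underline{D}$ is pure if $D=D_\sqcap\cup D_\sqcup$, and trivial if $\top\sqcap\top=\bot\sqcup\bot$.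 The quasi-order $\sqsubseteq$ on $D$ is: $x\sqsubseteq y$ iff $x\sqcap y=x\sqcap x$ and $x\sqcup y=y\sqcup y$. It is known that $(D_\sqcap;\sqcap,\vee,\neg,\bot,\neg\bot)$ and $(D_\sqcup;\wedge,\sqcup,\lrcorner,\lrcorner\top,\top)$ are Boolean algebras whose orders are the restrictions of $\sqsubseteq$. For posets $P$ with a greatest element $1_P$ and $Q$ with a least element $0_Q$, the glued sum $P\overset{\bullet}{+}Q$ is the ordinal sum $P+Q$ (on $P\cup Q$, with $x\le y$ if $x,y\in P$ and $x\le_P y$, or $x,y\in Q$ and $x\le_Q y$, or $x\in P,y\in Q$) in which $1_P$ and $0_Q$ are identified. *)

theory Defs
  imports "HOL-Algebra.Order"
begin

section \<open>Double Boolean algebras\<close>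

record 'a dba = "'a partial_object" +
  dmeet :: "'a \<Rightarrow> 'a \<Rightarrow> 'a" (infixl \<open>\<sqinter>\<index>\<close> 70)
  djoin :: "'a \<Rightarrow> 'a \<Rightarrow> 'a" (infixl \<open>\<squnion>\<index>\<close> 65)
  dneg :: "'a \<Rightarrow> 'a" (\<open>\<^bold>\<not>\<index> _\<close> [81] 80)
  dopp :: "'a \<Rightarrow> 'a" (\<open>\<^bold>\<rfloor>\<index> _\<close> [81] 80)
  dbot :: 'a (\<open>\<^bold>\<bottom>\<index>\<close>)
  dtop :: 'a (\<open>\<^bold>\<top>\<index>\<close>)

definition dvee :: "('a, 'm) dba_scheme \<Rightarrow> 'a \<Rightarrow> 'a \<Rightarrow> 'a" (infixl \<open>\<^bold>\<or>\<index>\<close> 65)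
  where "x \<^bold>\<or>\<^bsub>D\<^esub> y = \<^bold>\<not>\<^bsub>D\<^esub> (\<^bold>\<not>\<^bsub>D\<^esub> x \<sqinter>\<^bsub>D\<^esub> \<^bold>\<not>\<^bsub>D\<^esub> y)"

definition dwedge :: "('a, 'm) dba_scheme \<Rightarrow> 'a \<Rightarrow> 'a \<Rightarrow> 'a" (infixl \<open>\<^bold>\<and>\<index>\<close> 70)
  where "x \<^bold>\<and>\<^bsub>D\<^esub> y = \<^bold>\<rfloor>\<^bsub>D\<^esub> (\<^bold>\<rfloor>\<^bsub>D\<^esub> x \<squnion>\<^bsub>D\<^esub> \<^bold>\<rfloor>\<^bsub>D\<^esub> y)"

locale double_boolean_algebra =
  fixes D (structure)
  assumes meet_closed: "x \<in> carrier D \<Longrightarrow> y \<in> carrier D \<Longrightarrow> x \<sqinter> y \<in> carrier D"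
    and join_closed: "x \<in> carrier D \<Longrightarrow> y \<in> carrier D \<Longrightarrow> x \<squnion> y \<in> carrier D"
    and neg_closed: "x \<in> carrier D \<Longrightarrow> \<^bold>\<not> x \<in> carrier D"
    and opp_closed: "x \<in> carrier D \<Longrightarrow> \<^bold>\<rfloor> x \<in> carrier D"
    and bot_closed: "\<^bold>\<bottom> \<in> carrier D"
    and top_closed: "\<^bold>\<top> \<in> carrier D"
    and meet_idem_left: "x \<in> carrier D \<Longrightarrow> y \<in> carrier D \<Longrightarrow> (x \<sqinter> x) \<sqinter> y = x \<sqinter> y"
    and join_idem_left: "x \<in> carrier D \<Longrightarrow> y \<in> carrier D \<Longrightarrow> (x \<squnion> x) \<squnion> y = x \<squnion> y"
    and meet_comm: "x \<in> carrier D \<Longrightarrow> y \<in> carrier D \<Longrightarrow> x \<sqinter> y = y \<sqinter> x"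
    and join_comm: "x \<in> carrier D \<Longrightarrow> y \<in> carrier D \<Longrightarrow> x \<squnion> y = y \<squnion> x"
    and meet_assoc: "x \<in> carrier D \<Longrightarrow> y \<in> carrier D \<Longrightarrow> z \<in> carrier D \<Longrightarrow>
      x \<sqinter> (y \<sqinter> z) = (x \<sqinter> y) \<sqinter> z"
    and join_assoc: "x \<in> carrier D \<Longrightarrow> y \<in> carrier D \<Longrightarrow> z \<in> carrier D \<Longrightarrow>
      x \<squnion> (y \<squnion> z) = (x \<squnion> y) \<squnion> z"
    and meet_join_absorb: "x \<in> carrier D \<Longrightarrow> y \<in> carrier D \<Longrightarrow> x \<sqinter> (x \<squnion> y) = x \<sqinter> x"
    and join_meet_absorb: "x \<in> carrier D \<Longrightarrow> y \<in> carrier D \<Longrightarrow> x \<squnion> (x \<sqinter> y) = x \<squnion> x"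
    and meet_vee_absorb: "x \<in> carrier D \<Longrightarrow> y \<in> carrier D \<Longrightarrow> x \<sqinter> (x \<^bold>\<or> y) = x \<sqinter> x"
    and join_wedge_absorb: "x \<in> carrier D \<Longrightarrow> y \<in> carrier D \<Longrightarrow> x \<squnion> (x \<^bold>\<and> y) = x \<squnion> x"
    and meet_vee_distrib: "x \<in> carrier D \<Longrightarrow> y \<in> carrier D \<Longrightarrow> z \<in> carrier D \<Longrightarrow>
      x \<sqinter> (y \<^bold>\<or> z) = (x \<sqinter> y) \<^bold>\<or> (x \<sqinter> z)"
    and join_wedge_distrib: "x \<in> carrier D \<Longrightarrow> y \<in> carrier D \<Longrightarrow> z \<in> carrier D \<Longrightarrow>
      x \<squnion> (y \<^bold>\<and> z) = (x \<squnion> y) \<^bold>\<and> (x \<squnion> z)"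
    and neg_neg_meet: "x \<in> carrier D \<Longrightarrow> y \<in> carrier D \<Longrightarrow> \<^bold>\<not> (\<^bold>\<not> (x \<sqinter> y)) = x \<sqinter> y"
    and opp_opp_join: "x \<in> carrier D \<Longrightarrow> y \<in> carrier D \<Longrightarrow> \<^bold>\<rfloor> (\<^bold>\<rfloor> (x \<squnion> y)) = x \<squnion> y"
    and neg_meet_idem: "x \<in> carrier D \<Longrightarrow> \<^bold>\<not> (x \<sqinter> x) = \<^bold>\<not> x"
    and opp_join_idem: "x \<in> carrier D \<Longrightarrow> \<^bold>\<rfloor> (x \<squnion> x) = \<^bold>\<rfloor> x"
    and meet_neg: "x \<in> carrier D \<Longrightarrow> x \<sqinter> \<^bold>\<not> x = \<^bold>\<bottom>"
    and join_opp: "x \<in> carrier D \<Longrightarrow> x \<squnion> \<^bold>\<rfloor> x = \<^bold>\<top>"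
    and neg_bot: "\<^bold>\<not> \<^bold>\<bottom> = \<^bold>\<top> \<sqinter> \<^bold>\<top>"
    and opp_top: "\<^bold>\<rfloor> \<^bold>\<top> = \<^bold>\<bottom> \<squnion> \<^bold>\<bottom>"
    and neg_top: "\<^bold>\<not> \<^bold>\<top> = \<^bold>\<bottom>"
    and opp_bot: "\<^bold>\<rfloor> \<^bold>\<bottom> = \<^bold>\<top>"
    and idem_interchange: "x \<in> carrier D \<Longrightarrow> (x \<sqinter> x) \<squnion> (x \<sqinter> x) = (x \<squnion> x) \<sqinter> (x \<squnion> x)"

definition meet_idems :: "('a, 'm) dba_scheme \<Rightarrow> 'a set"
  where "meet_idems D = {x \<in> carrier D. x \<sqinter>\<^bsub>D\<^esub> x = x}"

definition join_idems :: "('a, 'm) dba_scheme \<Rightarrow> 'a set"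
  where "join_idems D = {x \<in> carrier D. x \<squnion>\<^bsub>D\<^esub> x = x}"

definition pure_dba :: "('a, 'm) dba_scheme \<Rightarrow> bool"
  where "pure_dba D \<longleftrightarrow> carrier D = meet_idems D \<union> join_idems D"

definition trivial_dba :: "('a, 'm) dba_scheme \<Rightarrow> bool"
  where "trivial_dba D \<longleftrightarrow> \<^bold>\<top>\<^bsub>D\<^esub> \<sqinter>\<^bsub>D\<^esub> \<^bold>\<top>\<^bsub>D\<^esub> = \<^bold>\<bottom>\<^bsub>D\<^esub> \<squnion>\<^bsub>D\<^esub> \<^bold>\<bottom>\<^bsub>D\<^esub>"

definition dba_le :: "('a, 'm) dba_scheme \<Rightarrow> 'a \<Rightarrow> 'a \<Rightarrow> bool"
  where "dba_le D x y \<longleftrightarrow> x \<sqinter>\<^bsub>D\<^esub> y = x \<sqinter>\<^bsub>D\<^esub> x \<and> x \<squnion>\<^bsub>D\<^esub> y = y \<squnion>\<^bsub>D\<^esub> y"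

text \<open>The relation is cut down to \<^term>\<open>A\<close>, so that equality of two such structures
  depends only on the order between elements of the carriers.\<close>

definition dba_order :: "('a, 'm) dba_scheme \<Rightarrow> 'a set \<Rightarrow> 'a gorder"
  where "dba_order D A =
    \<lparr>carrier = A, eq = (=), le = (\<lambda>x y. x \<in> A \<and> y \<in> A \<and> dba_le D x y)\<rparr>"


section \<open>Glued sums of posets\<close>

text \<open>The identification of the greatest element of \<^term>\<open>P\<close> with the least element of
  \<^term>\<open>Q\<close> is expressed by letting the two carriers overlap in exactly that element.\<close>

definition glueable :: "'a gorder \<Rightarrow> 'a gorder \<Rightarrow> bool"
  where "glueable P Q \<longleftrightarrow> partial_order P \<and> partial_order Q \<and>
    (\<exists>g. greatest P g (carrier P) \<and> least Q g (carrier Q) \<and> carrier P \<inter> carrier Q = {g})"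

definition glued_sum :: "'a gorder \<Rightarrow> 'a gorder \<Rightarrow> 'a gorder"
  where "glued_sum P Q =
    \<lparr>carrier = carrier P \<union> carrier Q,
     eq = (=),
     le = (\<lambda>x y. (x \<in> carrier P \<and> y \<in> carrier P \<and> x \<sqsubseteq>\<^bsub>P\<^esub> y) \<or>
                 (x \<in> carrier Q \<and> y \<in> carrier Q \<and> x \<sqsubseteq>\<^bsub>Q\<^esub> y) \<or>
                 (x \<in> carrier P \<and> y \<in> carrier Q))\<rparr>"


section \<open>Boolean algebras on a carrier set\<close>

record 'a bool_alg = "'a partial_object" +
  binf :: "'a \<Rightarrow> 'a \<Rightarrow> 'a" (infixl \<open>\<curlywedge>\<index>\<close> 70)
  bsup :: "'a \<Rightarrow> 'a \<Rightarrow> 'a" (infixl \<open>\<curlyvee>\<index>\<close> 65)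
  bcompl :: "'a \<Rightarrow> 'a"
  bzero :: 'a
  bone :: 'a

text \<open>The axioms are those of \<^locale>\<open>abstract_boolean_algebra\<close>, relativised to a carrier,
  together with the absorption laws. The one-element Boolean algebra is allowed.\<close>

locale bool_algebra =
  fixes B (structure)
  assumes inf_closed: "x \<in> carrier B \<Longrightarrow> y \<in> carrier B \<Longrightarrow> x \<curlywedge> y \<in> carrier B"
    and sup_closed: "x \<in> carrier B \<Longrightarrow> y \<in> carrier B \<Longrightarrow> x \<curlyvee> y \<in> carrier B"
    and compl_closed: "x \<in> carrier B \<Longrightarrow> bcompl B x \<in> carrier B"
    and zero_closed: "bzero B \<in> carrier B"
    and one_closed: "bone B \<in> carrier B"
    and inf_assoc: "x \<in> carrier B \<Longrightarrow> y \<in> carrier B \<Longrightarrow> z \<in> carrier B \<Longrightarrow>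
      (x \<curlywedge> y) \<curlywedge> z = x \<curlywedge> (y \<curlywedge> z)"
    and sup_assoc: "x \<in> carrier B \<Longrightarrow> y \<in> carrier B \<Longrightarrow> z \<in> carrier B \<Longrightarrow>
      (x \<curlyvee> y) \<curlyvee> z = x \<curlyvee> (y \<curlyvee> z)"
    and inf_comm: "x \<in> carrier B \<Longrightarrow> y \<in> carrier B \<Longrightarrow> x \<curlywedge> y = y \<curlywedge> x"
    and sup_comm: "x \<in> carrier B \<Longrightarrow> y \<in> carrier B \<Longrightarrow> x \<curlyvee> y = y \<curlyvee> x"
    and inf_sup_absorb: "x \<in> carrier B \<Longrightarrow> y \<in> carrier B \<Longrightarrow> x \<curlywedge> (x \<curlyvee> y) = x"
    and sup_inf_absorb: "x \<in> carrier B \<Longrightarrow> y \<in> carrier B \<Longrightarrow> x \<curlyvee> (x \<curlywedge> y) = x"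
    and inf_sup_distrib: "x \<in> carrier B \<Longrightarrow> y \<in> carrier B \<Longrightarrow> z \<in> carrier B \<Longrightarrow>
      x \<curlywedge> (y \<curlyvee> z) = (x \<curlywedge> y) \<curlyvee> (x \<curlywedge> z)"
    and sup_inf_distrib: "x \<in> carrier B \<Longrightarrow> y \<in> carrier B \<Longrightarrow> z \<in> carrier B \<Longrightarrow>
      x \<curlyvee> (y \<curlywedge> z) = (x \<curlyvee> y) \<curlywedge> (x \<curlyvee> z)"
    and inf_one: "x \<in> carrier B \<Longrightarrow> x \<curlywedge> bone B = x"
    and sup_zero: "x \<in> carrier B \<Longrightarrow> x \<curlyvee> bzero B = x"
    and inf_compl: "x \<in> carrier B \<Longrightarrow> x \<curlywedge> bcompl B x = bzero B"
    and sup_compl: "x \<in> carrier B \<Longrightarrow> x \<curlyvee> bcompl B x = bone B"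

definition bool_alg_order :: "'a bool_alg \<Rightarrow> 'a gorder"
  where "bool_alg_order B =
    \<lparr>carrier = carrier B, eq = (=),
     le = (\<lambda>x y. x \<in> carrier B \<and> y \<in> carrier B \<and> x \<curlywedge>\<^bsub>B\<^esub> y = x)\<rparr>"

text \<open>The algebra on the glued sum of two Boolean algebras that meet exactly in
  \<^term>\<open>bone P\<close> = \<^term>\<open>bzero Q\<close>. The cases of the two binary operations overlap when
  an argument is the common element, but prescribe the same value there, so their order is
  immaterial.\<close>

definition glued_dba :: "'a bool_alg \<Rightarrow> 'a bool_alg \<Rightarrow> 'a dba"
  where "glued_dba P Q =
    \<lparr>carrier = carrier (glued_sum (bool_alg_order P) (bool_alg_order Q)),
     dmeet = (\<lambda>x y. if x \<in> carrier P \<and> y \<in> carrier P then x \<curlywedge>\<^bsub>P\<^esub> y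
                    else if x \<in> carrier Q \<and> y \<in> carrier Q then bone P
                    else if x \<in> carrier P \<and> y \<in> carrier Q then x
                    else y),
     djoin = (\<lambda>x y. if x \<in> carrier Q \<and> y \<in> carrier Q then x \<curlyvee>\<^bsub>Q\<^esub> y
                    else if x \<in> carrier P \<and> y \<in> carrier P then bzero Q
                    else if x \<in> carrier P \<and> y \<in> carrier Q then y
                    else x),
     dneg = (\<lambda>x. if x \<in> carrier P then bcompl P x else bzero P),
     dopp = (\<lambda>x. if x \<in> carrier Q then bcompl Q x else bone Q),
     dbot = bzero P,
     dtop = bone Q\<rparr>"

end

(* In a trivial algebra put e = top meet top = bot join bot. For x in D_meet the element x join x
   is idempotent for both operations, and the only such element is e; dually for D_join. Hence e
   is the top of D_meet and the bottom of D_join, and everything in D_meet lies below everything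
   in D_join.

   For the converse, let p be the retraction of P + Q onto P collapsing Q to 1_P, and q the
   retraction onto Q collapsing P to 0_Q. The meet and the negation of the glued algebra are those
   of P pulled back along p, the join and the opposition those of Q pulled back along q, and p is
   constant on Q, q on P. This reduces every axiom to a Boolean identity. *)

theory Submission
  imports Defs
begin

section \<open>Pure and trivial double Boolean algebras\<close>

context double_boolean_algebra
begin

lemma meet_idem_right: "x \<in> carrier D \<Longrightarrow> y \<in> carrier D \<Longrightarrow> x \<sqinter> (y \<sqinter> y) = x \<sqinter> y"
  by (metis meet_closed meet_comm meet_idem_left)

lemma join_idem_right: "x \<in> carrier D \<Longrightarrow> y \<in> carrier D \<Longrightarrow> x \<squnion> (y \<squnion> y) = x \<squnion> y"
  by (metis join_closed join_comm join_idem_left)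

text \<open>Top is \<open>x\<close> joined with its opposite, so absorption applies; dually,
  \<open>join_bot\<close> uses bottom as a meet with \<open>x\<close>.\<close>

lemma meet_top: "x \<in> carrier D \<Longrightarrow> x \<sqinter> \<^bold>\<top> = x \<sqinter> x"
  by (metis join_opp meet_join_absorb opp_closed)

lemma join_bot: "x \<in> carrier D \<Longrightarrow> x \<squnion> \<^bold>\<bottom> = x \<squnion> x"
  by (metis meet_neg join_meet_absorb neg_closed)

lemma dba_le_refl: "dba_le D x x"
  by (simp add: dba_le_def)

text \<open>A factor may be replaced by its square, and the hypotheses exchange squares for
  products, so the middle element can be inserted and then removed.\<close>

lemma dba_le_trans:
  assumes "dba_le D x y" "dba_le D y z" "x \<in> carrier D" "y \<in> carrier D" "z \<in> carrier D"
  shows "dba_le D x z"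
proof -
  have "x \<sqinter> z = x \<sqinter> y \<sqinter> z"
    using assms by (metis dba_le_def meet_idem_left)
  also have "\<dots> = x \<sqinter> x"
    using assms by (metis dba_le_def meet_assoc meet_idem_right)
  finally have meet: "x \<sqinter> z = x \<sqinter> x" .
  have "x \<squnion> z = x \<squnion> (y \<squnion> z)"
    using assms by (metis dba_le_def join_idem_right)
  also have "\<dots> = z \<squnion> z"
    using assms by (metis dba_le_def join_assoc join_idem_left)
  finally show ?thesis
    using meet by (simp add: dba_le_def)
qed

text \<open>Mutual comparability only yields equal meet-squares and equal join-squares. Purity makes
  each element one of its own squares; if the two are of different kinds,
  \<open>idem_interchange\<close> equates them.\<close>

lemma dba_le_antisym:
  assumes "pure_dba D" "dba_le D x y" "dba_le D y x" "x \<in> carrier D" "y \<in> carrier D"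
  shows "x = y"
proof -
  have "x \<sqinter> x = y \<sqinter> y" "x \<squnion> x = y \<squnion> y"
    using assms by (metis dba_le_def meet_comm, metis dba_le_def join_comm)
  moreover have "x \<sqinter> x = x \<or> x \<squnion> x = x" "y \<sqinter> y = y \<or> y \<squnion> y = y"
    using assms unfolding pure_dba_def meet_idems_def join_idems_def by blast+
  ultimately show ?thesis
    using idem_interchange assms(4,5) by metis
qed

lemma partial_order_dba_order:
  assumes "pure_dba D" "A \<subseteq> carrier D"
  shows "partial_order (dba_order D A)"
proof unfold_locales
  fix x y z
  assume "x \<sqsubseteq>\<^bsub>dba_order D A\<^esub> y" "y \<sqsubseteq>\<^bsub>dba_order D A\<^esub> z"
    "x \<in> carrier (dba_order D A)" "y \<in> carrier (dba_order D A)" "z \<in> carrier (dba_order D A)"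
  then show "x \<sqsubseteq>\<^bsub>dba_order D A\<^esub> z"
    using assms(2) dba_le_trans[of x y z] by (auto simp: dba_order_def)
qed (use assms in \<open>auto simp: dba_order_def dba_le_refl intro: dba_le_antisym dest: subsetD\<close>)

end

section \<open>Triviality: the common element and the two halves\<close>

locale trivial_double_boolean_algebra = double_boolean_algebra +
  assumes trivial: "trivial_dba D"
begin

definition glue :: 'a
  where "glue = \<^bold>\<top> \<sqinter> \<^bold>\<top>"

lemma glue_eq: "glue = \<^bold>\<bottom> \<squnion> \<^bold>\<bottom>"
  using trivial by (simp add: glue_def trivial_dba_def)

lemma glue_closed: "glue \<in> carrier D"
  by (simp add: glue_def meet_closed top_closed)

text \<open>As the meet-square of top, \<open>glue\<close> acts on meets like top; as the
  join-square of bottom, it acts on joins like bottom in \<open>join_glue\<close>.\<close>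

lemma meet_glue: "x \<in> carrier D \<Longrightarrow> x \<sqinter> glue = x \<sqinter> x"
  unfolding glue_def by (metis meet_idem_right meet_top top_closed)

lemma join_glue: "x \<in> carrier D \<Longrightarrow> x \<squnion> glue = x \<squnion> x"
  unfolding glue_eq by (metis join_idem_right join_bot bot_closed)

lemma glue_meet_idem: "glue \<sqinter> glue = glue"
  by (simp add: glue_def meet_closed meet_idem_left meet_idem_right top_closed)

lemma glue_join_idem: "glue \<squnion> glue = glue"
  by (simp add: glue_eq join_closed join_idem_left join_idem_right bot_closed)

lemma idem_both_eq_glue:
  assumes "x \<in> carrier D" "x \<sqinter> x = x" "x \<squnion> x = x"
  shows "x = glue"
proof -
  \<comment> \<open>Absorption evaluates \<open>glue \<squnion> (glue \<sqinter> x)\<close> to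
    \<open>glue\<close>; as \<open>glue\<close> is neutral on \<open>x\<close> for both operations,
    the same term is also \<open>x\<close>.\<close>
  have "glue = glue \<squnion> (glue \<sqinter> x)"
    using assms(1) by (simp add: join_meet_absorb glue_closed glue_join_idem)
  also have "\<dots> = x"
    using assms by (metis meet_comm join_comm glue_closed meet_glue join_glue)
  finally show ?thesis by simp
qed

lemma meet_idems_Int_join_idems: "meet_idems D \<inter> join_idems D = {glue}"
  by (auto simp: meet_idems_def join_idems_def glue_closed glue_meet_idem glue_join_idem
      intro: idem_both_eq_glue)

lemma glue_in_idems: "glue \<in> meet_idems D" "glue \<in> join_idems D"
  using meet_idems_Int_join_idems by auto

lemma join_self_eq_glue:
  assumes "x \<in> meet_idems D"
  shows "x \<squnion> x = glue"
proof (rule idem_both_eq_glue)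
  \<comment> \<open>Since \<open>x \<sqinter> x = x\<close>, this is \<open>idem_interchange\<close>
    read from right to left.\<close>
  show "(x \<squnion> x) \<sqinter> (x \<squnion> x) = x \<squnion> x"
    using assms by (metis (mono_tags) idem_interchange meet_idems_def mem_Collect_eq)
qed (use assms in \<open>simp_all add: meet_idems_def join_closed join_idem_left join_idem_right\<close>)

lemma meet_self_eq_glue:
  assumes "x \<in> join_idems D"
  shows "x \<sqinter> x = glue"
proof (rule idem_both_eq_glue)
  show "(x \<sqinter> x) \<squnion> (x \<sqinter> x) = x \<sqinter> x"
    using assms by (metis (mono_tags) idem_interchange join_idems_def mem_Collect_eq)
qed (use assms in \<open>simp_all add: join_idems_def meet_closed meet_idem_left meet_idem_right\<close>)

text \<open>The meet-square of \<open>y\<close> and the join-square of \<open>x\<close> are both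
  \<open>glue\<close>; replacing those factors by their squares leaves a meet and a join with
  \<open>glue\<close>.\<close>

lemma dba_le_meet_idems_join_idems:
  assumes "x \<in> meet_idems D" "y \<in> join_idems D"
  shows "dba_le D x y"
proof -
  have carr: "x \<in> carrier D" "y \<in> carrier D"
    using assms by (auto simp: meet_idems_def join_idems_def)
  have "x \<sqinter> y = x \<sqinter> x"
    using carr meet_self_eq_glue[OF assms(2)] by (metis meet_idem_right meet_glue)
  moreover have "x \<squnion> y = y \<squnion> y"
    using carr join_self_eq_glue[OF assms(1)] by (metis join_idem_left join_comm glue_closed join_glue)
  ultimately show ?thesis
    by (simp add: dba_le_def)
qed

text \<open>A glued sum has no clause placing its upper summand below its lower one, so such a
  comparison may only occur at the common element.\<close>

lemma dba_le_join_idems_meet_idems: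
  assumes "x \<in> join_idems D" "y \<in> meet_idems D" "dba_le D x y"
  shows "x = glue" "y = glue"
proof -
  have carr: "x \<in> carrier D" "y \<in> carrier D" and idem: "x \<squnion> x = x" "y \<sqinter> y = y"
    using assms by (auto simp: meet_idems_def join_idems_def)
  \<comment> \<open>The right-hand side is computed twice: \<open>y \<squnion> y\<close> is
    \<open>glue\<close>, which is neutral on \<open>x\<close>; and \<open>x\<close> is absorbed
    because it lies below \<open>y\<close>.\<close>
  have "x = x \<squnion> (y \<squnion> y)"
    using carr(1) idem(1) join_self_eq_glue[OF assms(2)] by (simp add: join_glue)
  also have "\<dots> = glue"
    using carr assms(3) join_self_eq_glue[OF assms(2)] by (metis join_idem_right dba_le_def)
  finally show "x = glue" .
  then show "y = glue"
    using carr idem assms(3) by (metis dba_le_def glue_closed glue_meet_idem meet_comm meet_glue)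
qed

text \<open>The ambient set \<open>A\<close> is left free because the bound is wanted both in
  \<open>meet_idems D\<close> as a poset of its own and in the whole carrier.\<close>

lemma greatest_meet_idems:
  assumes "meet_idems D \<subseteq> A" "A \<subseteq> carrier D"
  shows "greatest (dba_order D A) glue (meet_idems D)"
  using assms glue_in_idems dba_le_meet_idems_join_idems
  by (auto simp: greatest_def dba_order_def)

lemma least_join_idems:
  assumes "join_idems D \<subseteq> A" "A \<subseteq> carrier D"
  shows "least (dba_order D A) glue (join_idems D)"
  using assms glue_in_idems dba_le_meet_idems_join_idems
  by (auto simp: least_def dba_order_def)

lemma glueable_idems:
  assumes "pure_dba D"
  shows "glueable (dba_order D (meet_idems D)) (dba_order D (join_idems D))"
proof -
  have "meet_idems D \<subseteq> carrier D" "join_idems D \<subseteq> carrier D"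
    by (auto simp: meet_idems_def join_idems_def)
  then show ?thesis
    using assms greatest_meet_idems[of "meet_idems D"] least_join_idems[of "join_idems D"]
      meet_idems_Int_join_idems partial_order_dba_order
    unfolding glueable_def by (auto simp: dba_order_def)
qed

lemma dba_order_eq_glued_sum:
  assumes "pure_dba D"
  shows "dba_order D (carrier D) =
    glued_sum (dba_order D (meet_idems D)) (dba_order D (join_idems D))"
proof -
  have carr: "carrier D = meet_idems D \<union> join_idems D"
    using assms by (simp add: pure_dba_def)
  show ?thesis
    unfolding dba_order_def glued_sum_def carr
    \<comment> \<open>A comparison from \<open>join_idems D\<close> to \<open>meet_idems D\<close>
      has both ends equal to \<open>glue\<close>, which lies in both halves, so a clause of the
      glued sum covers it.\<close>
    using dba_le_meet_idems_join_idems dba_le_join_idems_meet_idems glue_in_idems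
    by (simp add: fun_eq_iff) blast
qed

end

section \<open>Boolean algebras on a carrier\<close>

context bool_algebra
begin

lemma inf_idem: "x \<in> carrier B \<Longrightarrow> x \<curlywedge> x = x"
  by (metis inf_sup_absorb sup_zero zero_closed)

lemma sup_idem: "x \<in> carrier B \<Longrightarrow> x \<curlyvee> x = x"
  by (metis sup_inf_absorb inf_one one_closed)

lemma inf_left_idem: "x \<in> carrier B \<Longrightarrow> y \<in> carrier B \<Longrightarrow> x \<curlywedge> (x \<curlywedge> y) = x \<curlywedge> y"
  by (metis inf_assoc inf_idem)

lemma sup_left_idem: "x \<in> carrier B \<Longrightarrow> y \<in> carrier B \<Longrightarrow> x \<curlyvee> (x \<curlyvee> y) = x \<curlyvee> y"
  by (metis sup_assoc sup_idem)

lemma inf_zero: "x \<in> carrier B \<Longrightarrow> x \<curlywedge> bzero B = bzero B"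
  by (metis compl_closed inf_compl inf_left_idem)

lemma sup_one: "x \<in> carrier B \<Longrightarrow> x \<curlyvee> bone B = bone B"
  by (metis compl_closed sup_compl sup_left_idem)

text \<open>Both candidates equal their common meet: each is met with one, written as the join of
  \<open>x\<close> and the other, and its own meet with \<open>x\<close> vanishes.\<close>

lemma compl_unique:
  assumes "x \<in> carrier B" "y \<in> carrier B" "x \<curlywedge> y = bzero B" "x \<curlyvee> y = bone B"
  shows "bcompl B x = y"
proof -
  have "bcompl B x = bcompl B x \<curlywedge> (x \<curlyvee> y)"
    using assms by (simp add: inf_one compl_closed)
  also have "\<dots> = y \<curlywedge> bcompl B x"
    using assms
    by (metis compl_closed inf_closed inf_comm inf_compl inf_sup_distrib sup_comm sup_zero zero_closed)
  also have "\<dots> = y \<curlywedge> (x \<curlyvee> bcompl B x)"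
    using assms
    by (metis compl_closed inf_closed inf_comm inf_sup_distrib sup_comm sup_zero zero_closed)
  also have "\<dots> = y"
    using assms by (simp add: sup_compl inf_one)
  finally show ?thesis .
qed

lemma compl_compl: "x \<in> carrier B \<Longrightarrow> bcompl B (bcompl B x) = x"
  by (metis compl_closed compl_unique inf_comm inf_compl sup_comm sup_compl)

lemma compl_zero: "bcompl B (bzero B) = bone B"
  by (metis compl_unique inf_one one_closed sup_one zero_closed)

lemma compl_one: "bcompl B (bone B) = bzero B"
  by (metis compl_zero compl_compl zero_closed)

text \<open>By uniqueness of complements: distributivity reduces the zero condition to each
  complement separately, and the one condition to \<open>x\<close> and \<open>y\<close>
  separately.\<close>

lemma compl_inf:
  assumes "x \<in> carrier B" "y \<in> carrier B"
  shows "bcompl B (x \<curlywedge> y) = bcompl B x \<curlyvee> bcompl B y"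
proof (rule compl_unique)
  let ?x' = "bcompl B x" and ?y' = "bcompl B y"
  have "(x \<curlywedge> y) \<curlywedge> ?x' = bzero B" "(x \<curlywedge> y) \<curlywedge> ?y' = bzero B"
    using assms
    by (metis compl_closed inf_assoc inf_comm inf_compl inf_zero,
        metis compl_closed inf_assoc inf_compl inf_zero)
  then show "(x \<curlywedge> y) \<curlywedge> (?x' \<curlyvee> ?y') = bzero B"
    using assms by (simp add: inf_sup_distrib inf_closed compl_closed sup_zero zero_closed)
  have "(?x' \<curlyvee> ?y') \<curlyvee> x = bone B" "(?x' \<curlyvee> ?y') \<curlyvee> y = bone B"
    using assms
    by (metis compl_closed sup_assoc sup_comm sup_compl sup_one,
        metis compl_closed sup_assoc sup_comm sup_compl sup_one)
  then have "(?x' \<curlyvee> ?y') \<curlyvee> (x \<curlywedge> y) = bone B"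
    using assms by (simp add: sup_inf_distrib sup_closed compl_closed inf_one one_closed)
  then show "(x \<curlywedge> y) \<curlyvee> (?x' \<curlyvee> ?y') = bone B"
    using assms by (metis compl_closed inf_closed sup_closed sup_comm)
qed (use assms in \<open>simp_all add: inf_closed sup_closed compl_closed\<close>)

lemma compl_sup:
  assumes "x \<in> carrier B" "y \<in> carrier B"
  shows "bcompl B (x \<curlyvee> y) = bcompl B x \<curlywedge> bcompl B y"
  using assms by (metis compl_closed compl_compl compl_inf inf_closed)

end

section \<open>The double Boolean algebra on a glued sum\<close>

locale glued_bool_algebras =
  P: bool_algebra P + Q: bool_algebra Q for P Q :: "'a bool_alg" +
  assumes carrier_Int: "carrier P \<inter> carrier Q = {bone P}"
    and one_eq_zero: "bone P = bzero Q"
begin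

abbreviation G :: "'a dba"
  where "G \<equiv> glued_dba P Q"

definition p :: "'a \<Rightarrow> 'a"
  where "p x = (if x \<in> carrier P then x else bone P)"

definition q :: "'a \<Rightarrow> 'a"
  where "q x = (if x \<in> carrier Q then x else bzero Q)"

lemma p_closed [simp]: "p x \<in> carrier P"
  by (simp add: p_def P.one_closed)

lemma q_closed [simp]: "q x \<in> carrier Q"
  by (simp add: q_def Q.zero_closed)

lemma p_P [simp]: "x \<in> carrier P \<Longrightarrow> p x = x"
  by (simp add: p_def)

lemma q_Q [simp]: "x \<in> carrier Q \<Longrightarrow> q x = x"
  by (simp add: q_def)

lemma common_eq_one: "x \<in> carrier P \<Longrightarrow> x \<in> carrier Q \<Longrightarrow> x = bone P"
  using carrier_Int by auto

lemma p_Q [simp]: "x \<in> carrier Q \<Longrightarrow> p x = bone P"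
  using carrier_Int by (auto simp: p_def)

lemma q_P [simp]: "x \<in> carrier P \<Longrightarrow> q x = bone P"
  using carrier_Int one_eq_zero by (auto simp: q_def)

lemma carrier_G: "carrier G = carrier P \<union> carrier Q"
  by (simp add: glued_dba_def glued_sum_def bool_alg_order_def)

lemma bot_G: "\<^bold>\<bottom>\<^bsub>G\<^esub> = bzero P"
  by (simp add: glued_dba_def)

lemma top_G: "\<^bold>\<top>\<^bsub>G\<^esub> = bone Q"
  by (simp add: glued_dba_def)

text \<open>The default value outside \<open>P\<close> is the complement of \<open>bone P\<close>,
  where \<open>p\<close> sends such points, so no membership assumption arises.\<close>

lemma neg_G: "\<^bold>\<not>\<^bsub>G\<^esub> x = bcompl P (p x)"
  by (simp add: glued_dba_def p_def P.compl_one)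

lemma opp_G: "\<^bold>\<rfloor>\<^bsub>G\<^esub> x = bcompl Q (q x)"
  by (simp add: glued_dba_def q_def Q.compl_zero)

text \<open>Membership matters: for two points outside both summands the last branch of the
  definition returns \<open>y\<close>, whereas the right-hand side is \<open>bone P\<close>.\<close>

lemma meet_G:
  assumes "x \<in> carrier G" "y \<in> carrier G"
  shows "x \<sqinter>\<^bsub>G\<^esub> y = p x \<curlywedge>\<^bsub>P\<^esub> p y"
  using assms P.inf_comm[of "bone P"] unfolding carrier_G
  by (auto simp: glued_dba_def p_def P.inf_one P.one_closed dest: common_eq_one)

lemma join_G:
  assumes "x \<in> carrier G" "y \<in> carrier G"
  shows "x \<squnion>\<^bsub>G\<^esub> y = q x \<curlyvee>\<^bsub>Q\<^esub> q y"
  using assms one_eq_zero Q.sup_comm[of "bzero Q"] unfolding carrier_G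
  by (auto simp: glued_dba_def q_def Q.sup_zero Q.zero_closed dest: common_eq_one)

lemmas closed_simps [simp] =
  P.inf_closed P.sup_closed P.compl_closed P.zero_closed P.one_closed
  Q.inf_closed Q.sup_closed Q.compl_closed Q.zero_closed Q.one_closed

text \<open>Negations always land in \<open>P\<close>, so \<open>meet_G\<close> applies to them for
  arbitrary \<open>x\<close> and \<open>y\<close>, and De Morgan finishes.\<close>

lemma vee_G: "x \<^bold>\<or>\<^bsub>G\<^esub> y = p x \<curlyvee>\<^bsub>P\<^esub> p y"
  by (simp add: dvee_def neg_G meet_G carrier_G P.compl_inf P.compl_compl)

lemma wedge_G: "x \<^bold>\<and>\<^bsub>G\<^esub> y = q x \<curlywedge>\<^bsub>Q\<^esub> q y"
  by (simp add: dwedge_def opp_G join_G carrier_G Q.compl_sup Q.compl_compl)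

lemma one_P_in_Q [simp]: "bone P \<in> carrier Q"
  by (simp add: one_eq_zero)

lemmas op_simps = bot_G top_G neg_G opp_G meet_G join_G vee_G wedge_G

lemma double_boolean_algebra_G: "double_boolean_algebra G"
proof unfold_locales
  have in_G: "x \<in> carrier P \<Longrightarrow> x \<in> carrier G" "x \<in> carrier Q \<Longrightarrow> x \<in> carrier G" for x
    by (simp_all add: carrier_G)
  note [simp] = in_G op_simps
  note [simp] = P.inf_idem P.inf_one P.inf_compl P.inf_sup_absorb P.compl_compl
    P.compl_zero P.compl_one
  note [simp] = Q.sup_idem Q.sup_compl Q.sup_inf_absorb Q.compl_compl Q.compl_one
  \<comment> \<open>The shared element is normalised to \<open>bone P\<close>; the folded rules
    restate the laws of \<open>bzero Q\<close> in that form so that they still fire.\<close>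
  note [simp] = one_eq_zero[symmetric]
    Q.sup_zero[folded one_eq_zero] Q.compl_zero[folded one_eq_zero]
  \<comment> \<open>The axioms are grouped by number of variables, so each \<open>show\<close>
    depends only on the membership assumptions its goal provides.\<close>
  fix x y z
  show "\<^bold>\<bottom>\<^bsub>G\<^esub> \<in> carrier G" "\<^bold>\<top>\<^bsub>G\<^esub> \<in> carrier G"
    by simp_all
  show "\<^bold>\<not>\<^bsub>G\<^esub> \<^bold>\<bottom>\<^bsub>G\<^esub> = \<^bold>\<top>\<^bsub>G\<^esub> \<sqinter>\<^bsub>G\<^esub> \<^bold>\<top>\<^bsub>G\<^esub>" "\<^bold>\<rfloor>\<^bsub>G\<^esub> \<^bold>\<top>\<^bsub>G\<^esub> = \<^bold>\<bottom>\<^bsub>G\<^esub> \<squnion>\<^bsub>G\<^esub> \<^bold>\<bottom>\<^bsub>G\<^esub>"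
    "\<^bold>\<not>\<^bsub>G\<^esub> \<^bold>\<top>\<^bsub>G\<^esub> = \<^bold>\<bottom>\<^bsub>G\<^esub>" "\<^bold>\<rfloor>\<^bsub>G\<^esub> \<^bold>\<bottom>\<^bsub>G\<^esub> = \<^bold>\<top>\<^bsub>G\<^esub>"
    by simp_all
  assume x: "x \<in> carrier G"
  show "\<^bold>\<not>\<^bsub>G\<^esub> x \<in> carrier G" "\<^bold>\<rfloor>\<^bsub>G\<^esub> x \<in> carrier G"
    by simp_all
  \<comment> \<open>In the interchange law a meet lies in \<open>P\<close> and a join in
    \<open>Q\<close>, so both sides collapse to the common element.\<close>
  show "\<^bold>\<not>\<^bsub>G\<^esub> (x \<sqinter>\<^bsub>G\<^esub> x) = \<^bold>\<not>\<^bsub>G\<^esub> x" "\<^bold>\<rfloor>\<^bsub>G\<^esub> (x \<squnion>\<^bsub>G\<^esub> x) = \<^bold>\<rfloor>\<^bsub>G\<^esub> x"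
    "x \<sqinter>\<^bsub>G\<^esub> \<^bold>\<not>\<^bsub>G\<^esub> x = \<^bold>\<bottom>\<^bsub>G\<^esub>" "x \<squnion>\<^bsub>G\<^esub> \<^bold>\<rfloor>\<^bsub>G\<^esub> x = \<^bold>\<top>\<^bsub>G\<^esub>"
    "(x \<sqinter>\<^bsub>G\<^esub> x) \<squnion>\<^bsub>G\<^esub> (x \<sqinter>\<^bsub>G\<^esub> x) = (x \<squnion>\<^bsub>G\<^esub> x) \<sqinter>\<^bsub>G\<^esub> (x \<squnion>\<^bsub>G\<^esub> x)"
    using x by simp_all
  assume y: "y \<in> carrier G"
  show "x \<sqinter>\<^bsub>G\<^esub> y \<in> carrier G" "x \<squnion>\<^bsub>G\<^esub> y \<in> carrier G"
    using x y by simp_all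
  \<comment> \<open>In the mixed absorption laws the inner term lies in the other summand and is
    retracted to the common element, neutral for the outer operation.\<close>
  show "(x \<sqinter>\<^bsub>G\<^esub> x) \<sqinter>\<^bsub>G\<^esub> y = x \<sqinter>\<^bsub>G\<^esub> y" "(x \<squnion>\<^bsub>G\<^esub> x) \<squnion>\<^bsub>G\<^esub> y = x \<squnion>\<^bsub>G\<^esub> y"
    "x \<sqinter>\<^bsub>G\<^esub> (x \<squnion>\<^bsub>G\<^esub> y) = x \<sqinter>\<^bsub>G\<^esub> x" "x \<squnion>\<^bsub>G\<^esub> (x \<sqinter>\<^bsub>G\<^esub> y) = x \<squnion>\<^bsub>G\<^esub> x"
    "x \<sqinter>\<^bsub>G\<^esub> (x \<^bold>\<or>\<^bsub>G\<^esub> y) = x \<sqinter>\<^bsub>G\<^esub> x" "x \<squnion>\<^bsub>G\<^esub> (x \<^bold>\<and>\<^bsub>G\<^esub> y) = x \<squnion>\<^bsub>G\<^esub> x"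
    "\<^bold>\<not>\<^bsub>G\<^esub> (\<^bold>\<not>\<^bsub>G\<^esub> (x \<sqinter>\<^bsub>G\<^esub> y)) = x \<sqinter>\<^bsub>G\<^esub> y" "\<^bold>\<rfloor>\<^bsub>G\<^esub> (\<^bold>\<rfloor>\<^bsub>G\<^esub> (x \<squnion>\<^bsub>G\<^esub> y)) = x \<squnion>\<^bsub>G\<^esub> y"
    using x y by simp_all
  show "x \<sqinter>\<^bsub>G\<^esub> y = y \<sqinter>\<^bsub>G\<^esub> x" "x \<squnion>\<^bsub>G\<^esub> y = y \<squnion>\<^bsub>G\<^esub> x"
    using x y by (simp_all add: P.inf_comm Q.sup_comm)
  assume z: "z \<in> carrier G"
  show "x \<sqinter>\<^bsub>G\<^esub> (y \<sqinter>\<^bsub>G\<^esub> z) = (x \<sqinter>\<^bsub>G\<^esub> y) \<sqinter>\<^bsub>G\<^esub> z" "x \<squnion>\<^bsub>G\<^esub> (y \<squnion>\<^bsub>G\<^esub> z) = (x \<squnion>\<^bsub>G\<^esub> y) \<squnion>\<^bsub>G\<^esub> z"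
    using x y z by (simp_all add: P.inf_assoc Q.sup_assoc)
  show "x \<sqinter>\<^bsub>G\<^esub> (y \<^bold>\<or>\<^bsub>G\<^esub> z) = (x \<sqinter>\<^bsub>G\<^esub> y) \<^bold>\<or>\<^bsub>G\<^esub> (x \<sqinter>\<^bsub>G\<^esub> z)"
    "x \<squnion>\<^bsub>G\<^esub> (y \<^bold>\<and>\<^bsub>G\<^esub> z) = (x \<squnion>\<^bsub>G\<^esub> y) \<^bold>\<and>\<^bsub>G\<^esub> (x \<squnion>\<^bsub>G\<^esub> z)"
    using x y z by (simp_all add: P.inf_sup_distrib Q.sup_inf_distrib)
qed

lemma pure_dba_G: "pure_dba G"
  by (auto simp: pure_dba_def meet_idems_def join_idems_def meet_G join_G carrier_G
      P.inf_idem Q.sup_idem)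

text \<open>Top lies in \<open>Q\<close> and bottom in \<open>P\<close>, so \<open>p\<close> and
  \<open>q\<close> respectively send them to the common element.\<close>

lemma trivial_dba_G: "trivial_dba G"
  by (simp add: trivial_dba_def op_simps carrier_G P.inf_idem Q.sup_idem)

end

section \<open>Decomposition and converse construction combined\<close>

theorem theorem3p5:
  shows "(\<forall>D :: 'a dba.
      double_boolean_algebra D \<and> pure_dba D \<and> trivial_dba D \<longrightarrow>
        partial_order (dba_order D (carrier D)) \<and>
        glueable (dba_order D (meet_idems D)) (dba_order D (join_idems D)) \<and>
        dba_order D (carrier D) =
          glued_sum (dba_order D (meet_idems D)) (dba_order D (join_idems D)) \<and>
        (\<exists>g. greatest (dba_order D (carrier D)) g (meet_idems D) \<and>
             least (dba_order D (carrier D)) g (join_idems D) \<and>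
             meet_idems D \<inter> join_idems D = {g})) \<and>
    (\<forall>(P :: 'b bool_alg) (Q :: 'b bool_alg).
      bool_algebra P \<and> bool_algebra Q \<and>
      carrier P \<inter> carrier Q = {bone P} \<and> bone P = bzero Q \<longrightarrow>
        double_boolean_algebra (glued_dba P Q) \<and>
        pure_dba (glued_dba P Q) \<and>
        trivial_dba (glued_dba P Q))"
proof (rule conjI; intro allI impI)
  fix D :: "'a dba"
  assume D: "double_boolean_algebra D \<and> pure_dba D \<and> trivial_dba D"
  then interpret trivial_double_boolean_algebra D
    by (simp add: trivial_double_boolean_algebra.intro trivial_double_boolean_algebra_axioms.intro)
  have idems: "meet_idems D \<subseteq> carrier D" "join_idems D \<subseteq> carrier D"
    by (auto simp: meet_idems_def join_idems_def)
  show "partial_order (dba_order D (carrier D)) \<and>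
      glueable (dba_order D (meet_idems D)) (dba_order D (join_idems D)) \<and>
      dba_order D (carrier D) =
        glued_sum (dba_order D (meet_idems D)) (dba_order D (join_idems D)) \<and>
      (\<exists>g. greatest (dba_order D (carrier D)) g (meet_idems D) \<and>
           least (dba_order D (carrier D)) g (join_idems D) \<and>
           meet_idems D \<inter> join_idems D = {g})"
    \<comment> \<open>The witness is \<open>glue\<close>, with the whole carrier as ambient set for
      both bounds.\<close>
    using D partial_order_dba_order glueable_idems dba_order_eq_glued_sum
      greatest_meet_idems[OF idems(1)] least_join_idems[OF idems(2)] meet_idems_Int_join_idems
    by blast
next
  fix P Q :: "'b bool_alg"
  assume "bool_algebra P \<and> bool_algebra Q \<and>
    carrier P \<inter> carrier Q = {bone P} \<and> bone P = bzero Q"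
  then interpret glued_bool_algebras P Q
    by (simp add: glued_bool_algebras.intro glued_bool_algebras_axioms.intro)
  show "double_boolean_algebra (glued_dba P Q) \<and> pure_dba (glued_dba P Q) \<and>
      trivial_dba (glued_dba P Q)"
    using double_boolean_algebra_G pure_dba_G trivial_dba_G by blast
qed

end
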